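(* Let $\lambda$ and $\mu$ be infinite cardinals with $2^{\mu} \leq \lambda$. Then the product of any family of weakly initially $\lambda$-compact topological spaces is weakly initially $\mu$-compact.
   Context: No separation axiom is assumed on topological spaces. Products of topological spaces are Tychonoff products (product topology). For an infinite cardinal $\kappa$, a topological space $X$ is weakly initially $\kappa$-compact if and only if every open cover of $X$ of cardinality at most $\kappa$ has a finite subset whose union is dense in $X$. *)

theory Defs
  imports "HOL-Analysis.Analysis"
begin

unbundle cardinal_syntax

definition weakly_initially_compact :: "'k rel \<Rightarrow> 'a topology \<Rightarrow> bool" where
  "weakly_initially_compact \<kappa> X \<longleftrightarrow>
     (\<forall>\<U>. (\<forall>U\<in>\<U>. openin X U) \<and> \<Union>\<U> = topspace X \<and> |\<U>| \<le>o \<kappa>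
        \<longrightarrow> (\<exists>\<F>. \<F> \<subseteq> \<U> \<and> finite \<F> \<and> X closure_of (\<Union>\<F>) = topspace X))"

end

(* For an ultrafilter D on a set S, call x a D-limit of a family (Q s) of open sets indexed by S if
   every neighbourhood of x meets Q s for D-many s. A weakly initially lam-compact space with
   |D| <= lam has D-limits of all families of nonempty open sets: otherwise the complements of the
   closures of the unions of Q s over s in A, for A in D, form a cover, and finitely many of them miss
   Q s for D-many s. Since a finite intersection of D-large sets is D-large, D-limits of boxes can be
   found coordinatewise, so the existence of D-limits passes to products. Finally, if a cover UU with
   |UU| <= mu has no finite subfamily with dense union, take S to be the finite subfamilies F of UU,
   Q F the complement of the closure of the union of F, and D any ultrafilter containing {F. U in F}
   for all U in UU: a D-limit lies in no member of UU. Here |D| <= 2^|UU| <= 2^mu <= lam. *)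
theory Submission
  imports Defs "HOL-Algebra.Free_Abelian_Groups"
begin

section \<open>Ultrafilters as maximal families with the finite intersection property\<close>

definition fip_on :: "'s set \<Rightarrow> 's set set \<Rightarrow> bool" where
  "fip_on S D \<longleftrightarrow> D \<subseteq> Pow S \<and> (\<forall>C. C \<subseteq> D \<and> finite C \<longrightarrow> S \<inter> \<Inter>C \<noteq> {})"

text \<open>Maximality replaces the usual filter axioms, so that Zorn's lemma yields extensions
  directly; the closure properties are derived from it.\<close>

definition ultrafilter_on :: "'s set \<Rightarrow> 's set set \<Rightarrow> bool" where
  "ultrafilter_on S D \<longleftrightarrow> fip_on S D \<and> (\<forall>E. fip_on S E \<and> D \<subseteq> E \<longrightarrow> E = D)"

lemma fip_onD: "\<lbrakk>fip_on S D; C \<subseteq> D; finite C\<rbrakk> \<Longrightarrow> S \<inter> \<Inter>C \<noteq> {}"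
  by (simp add: fip_on_def)

lemma ultrafilter_on_imp_fip_on: "ultrafilter_on S D \<Longrightarrow> fip_on S D"
  by (simp add: ultrafilter_on_def)

text \<open>Zorn's lemma applies because a finite subfamily of the union of a nonempty chain already
  lies in one member of the chain.\<close>

lemma ultrafilter_on_extends:
  assumes "fip_on S B"
  obtains D where "ultrafilter_on S D" "B \<subseteq> D"
proof -
  let ?A = "{D. fip_on S D \<and> B \<subseteq> D}"
  have "\<exists>M\<in>?A. \<forall>X\<in>?A. M \<subseteq> X \<longrightarrow> X = M"
  proof (rule subset_Zorn_nonempty)
    show "?A \<noteq> {}" using assms by blast
    fix \<C> assume ne: "\<C> \<noteq> {}" and ch: "subset.chain ?A \<C>"
    have sub: "\<C> \<subseteq> ?A" using ch by (simp add: subset_chain_def)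
    have "S \<inter> \<Inter>C \<noteq> {}" if C: "C \<subseteq> \<Union>\<C>" "finite C" for C
    proof -
      obtain E where "E \<in> \<C>" "C \<subseteq> E"
        using finite_subset_Union_chain[OF C(2,1) ne ch] by blast
      then show ?thesis using sub C(2) fip_onD by blast
    qed
    moreover have "\<Union>\<C> \<subseteq> Pow S"
      using sub unfolding fip_on_def by (intro Union_least) blast
    moreover have "B \<subseteq> \<Union>\<C>"
      using sub ne by blast
    ultimately show "\<Union>\<C> \<in> ?A"
      by (simp add: fip_on_def)
  qed
  then obtain M where "fip_on S M" "B \<subseteq> M" and max: "\<And>E. E \<in> ?A \<Longrightarrow> M \<subseteq> E \<Longrightarrow> E = M"
    by auto
  moreover have "E = M" if "fip_on S E" "M \<subseteq> E" for E
    using max[of E] that \<open>B \<subseteq> M\<close> by auto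
  ultimately show ?thesis
    using that[of M] by (simp add: ultrafilter_on_def)
qed

text \<open>Adjoining \<open>W\<close> keeps the finite intersection property, so by maximality
  \<open>W\<close> was there already.\<close>

lemma ultrafilter_on_memI:
  assumes D: "ultrafilter_on S D" and W: "W \<subseteq> S"
    and meets: "\<And>C. C \<subseteq> D \<Longrightarrow> finite C \<Longrightarrow> S \<inter> \<Inter>C \<inter> W \<noteq> {}"
  shows "W \<in> D"
proof -
  have "S \<inter> \<Inter>C \<noteq> {}" if "C \<subseteq> insert W D" "finite C" for C
  proof -
    have "S \<inter> \<Inter>(C - {W}) \<inter> W \<noteq> {}"
      using that by (intro meets) auto
    then show ?thesis by blast
  qed
  then have "fip_on S (insert W D)"
    using D W by (auto simp: ultrafilter_on_def fip_on_def)
  then have "insert W D = D"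
    using D by (auto simp: ultrafilter_on_def)
  then show ?thesis by blast
qed

text \<open>The factor \<open>S\<close> covers \<open>C = {}\<close>, where \<open>\<Inter>C\<close>
  is \<open>UNIV\<close>.\<close>

lemma ultrafilter_on_Inter:
  assumes D: "ultrafilter_on S D" and C: "C \<subseteq> D" "finite C"
  shows "S \<inter> \<Inter>C \<in> D"
proof (rule ultrafilter_on_memI[OF D])
  fix C' assume "C' \<subseteq> D" "finite C'"
  then have "S \<inter> \<Inter>(C \<union> C') \<noteq> {}"
    using C by (intro fip_onD[OF ultrafilter_on_imp_fip_on[OF D]]) auto
  then show "S \<inter> \<Inter>C' \<inter> (S \<inter> \<Inter>C) \<noteq> {}" by blast
qed simp

text \<open>Testing single members suffices, as finite intersections are members again. The limit
  lemmas below obtain membership in \<open>D\<close> through this criterion.\<close>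

lemma ultrafilter_on_meets:
  assumes D: "ultrafilter_on S D" and W: "W \<subseteq> S"
    and meets: "\<And>A. A \<in> D \<Longrightarrow> A \<inter> W \<noteq> {}"
  shows "W \<in> D"
proof (rule ultrafilter_on_memI[OF D W])
  fix C assume "C \<subseteq> D" "finite C"
  then show "S \<inter> \<Inter>C \<inter> W \<noteq> {}"
    by (intro meets ultrafilter_on_Inter[OF D])
qed

section \<open>Limits of families of open sets along an ultrafilter, and their products\<close>

definition ultralimit_in :: "'a topology \<Rightarrow> 's set \<Rightarrow> 's set set \<Rightarrow> ('s \<Rightarrow> 'a set) \<Rightarrow> 'a \<Rightarrow> bool" where
  "ultralimit_in X S D Q x \<longleftrightarrow>
     x \<in> topspace X \<and> (\<forall>U. openin X U \<and> x \<in> U \<longrightarrow> {s \<in> S. U \<inter> Q s \<noteq> {}} \<in> D)"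

text \<open>This is \<open>D\<close>-pseudocompactness, for an ultrafilter on an arbitrary index
  set.\<close>

definition ultra_pseudocompact :: "'s set \<Rightarrow> 's set set \<Rightarrow> 'a topology \<Rightarrow> bool" where
  "ultra_pseudocompact S D X \<longleftrightarrow>
     (\<forall>Q. (\<forall>s\<in>S. openin X (Q s) \<and> Q s \<noteq> {}) \<longrightarrow> (\<exists>x. ultralimit_in X S D Q x))"

lemma weakly_initially_compact_imp_ultra_pseudocompact:
  assumes X: "weakly_initially_compact \<kappa> X"
    and D: "ultrafilter_on S D" and card: "|D| \<le>o \<kappa>"
  shows "ultra_pseudocompact S D X"
  unfolding ultra_pseudocompact_def
proof (intro allI impI)
  fix Q assume Q: "\<forall>s\<in>S. openin X (Q s) \<and> Q s \<noteq> {}"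
  have DS: "D \<subseteq> Pow S" using D by (auto simp: ultrafilter_on_def fip_on_def)
  define W where "W A = topspace X - X closure_of (\<Union>(Q ` A))" for A
  have "\<exists>x\<in>topspace X. \<forall>A\<in>D. x \<in> X closure_of (\<Union>(Q ` A))"
  proof (rule ccontr)
    assume "\<not> ?thesis"
    then have "\<Union>(W ` D) = topspace X"
      unfolding W_def by blast
    moreover have "\<forall>U\<in>W ` D. openin X U"
      by (auto simp: W_def)
    moreover have "|W ` D| \<le>o \<kappa>"
      using card card_of_image ordLeq_transitive by blast
    ultimately obtain \<F> where "\<F> \<subseteq> W ` D" "finite \<F>" "X closure_of \<Union>\<F> = topspace X"
      using X[unfolded weakly_initially_compact_def, rule_format, of "W ` D"] by auto
    then obtain C where C: "C \<subseteq> D" "finite C" and dense: "X closure_of (\<Union>(W ` C)) = topspace X"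
      using finite_subset_image[of \<F> W D] by blast
    obtain s where s: "s \<in> S" "\<And>A. A \<in> C \<Longrightarrow> s \<in> A"
      using fip_onD[OF ultrafilter_on_imp_fip_on[OF D] C] by blast
    \<comment> \<open>As \<open>s\<close> lies in \<open>A\<close>, the set \<open>Q s\<close> is
      part of the union whose closure \<open>W A\<close> avoids.\<close>
    have "Q s \<inter> W A = {}" if "A \<in> C" for A
    proof -
      have "A \<subseteq> S" using that C(1) DS by blast
      then have "\<Union>(Q ` A) \<subseteq> topspace X"
        using Q openin_subset by (intro UN_least) blast
      moreover have "Q s \<subseteq> \<Union>(Q ` A)"
        using s(2)[OF that] by blast
      ultimately have "Q s \<subseteq> X closure_of (\<Union>(Q ` A))"
        using closure_of_subset by fast
      then show ?thesis by (auto simp: W_def)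
    qed
    then have "Q s \<inter> \<Union>(W ` C) = {}" by blast
    \<comment> \<open>An open set disjoint from a set is disjoint from its closure, here the whole
      space; this contradicts \<open>Q s \<noteq> {}\<close>.\<close>
    then have "Q s \<inter> X closure_of (\<Union>(W ` C)) = {}"
      using openin_Int_closure_of_eq_empty Q s(1) by metis
    then show False
      using dense Q s(1) openin_subset by fastforce
  qed
  then obtain x where x: "x \<in> topspace X" "\<And>A. A \<in> D \<Longrightarrow> x \<in> X closure_of (\<Union>(Q ` A))"
    by blast
  have "{s \<in> S. U \<inter> Q s \<noteq> {}} \<in> D" if U: "openin X U" "x \<in> U" for U
  proof (rule ultrafilter_on_meets[OF D])
    fix A assume A: "A \<in> D"
    then have "U \<inter> \<Union>(Q ` A) \<noteq> {}"
      using x(2)[OF A] U unfolding in_closure_of by blast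
    then show "A \<inter> {s \<in> S. U \<inter> Q s \<noteq> {}} \<noteq> {}"
      using A DS by auto
  qed auto
  then show "\<exists>x. ultralimit_in X S D Q x"
    using x(1) unfolding ultralimit_in_def by blast
qed

text \<open>Lets a limit of boxes serve as a limit of the open sets containing them; in substance,
  \<open>D\<close> is closed under supersets.\<close>

lemma ultralimit_in_mono:
  assumes D: "ultrafilter_on S D" and lim: "ultralimit_in X S D B x"
    and sub: "\<And>s. s \<in> S \<Longrightarrow> B s \<subseteq> Q s"
  shows "ultralimit_in X S D Q x"
  unfolding ultralimit_in_def
proof (intro conjI allI impI)
  show "x \<in> topspace X" using lim by (simp add: ultralimit_in_def)
  fix U assume "openin X U \<and> x \<in> U"
  then have *: "{s \<in> S. U \<inter> B s \<noteq> {}} \<in> D"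
    using lim by (simp add: ultralimit_in_def)
  show "{s \<in> S. U \<inter> Q s \<noteq> {}} \<in> D"
  proof (rule ultrafilter_on_meets[OF D])
    fix A assume "A \<in> D"
    then have "S \<inter> \<Inter>{A, {s \<in> S. U \<inter> B s \<noteq> {}}} \<noteq> {}"
      using * by (intro fip_onD[OF ultrafilter_on_imp_fip_on[OF D]]) auto
    then obtain s where "s \<in> A" "s \<in> S" "U \<inter> B s \<noteq> {}"
      by auto
    then show "A \<inter> {s \<in> S. U \<inter> Q s \<noteq> {}} \<noteq> {}"
      using sub[of s] by auto
  qed auto
qed

text \<open>A basic neighbourhood restricts only finitely many coordinates \<open>J\<close>, and the
  finitely many sets \<open>G i\<close> together with any \<open>A\<close> in \<open>D\<close> share
  an index \<open>s\<close>.\<close>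

lemma ultralimit_in_product_topology:
  assumes D: "ultrafilter_on S D"
    and B: "\<And>s i. s \<in> S \<Longrightarrow> i \<in> I \<Longrightarrow> B s i \<noteq> {} \<and> B s i \<subseteq> topspace (X i)"
    and lim: "\<And>i. i \<in> I \<Longrightarrow> ultralimit_in (X i) S D (\<lambda>s. B s i) (x i)"
  shows "ultralimit_in (product_topology X I) S D (\<lambda>s. Pi\<^sub>E I (B s)) (restrict x I)"
  unfolding ultralimit_in_def
proof (intro conjI allI impI)
  show "restrict x I \<in> topspace (product_topology X I)"
    using lim by (auto simp: ultralimit_in_def)
  fix U assume U: "openin (product_topology X I) U \<and> restrict x I \<in> U"
  obtain V where fin: "finite {i \<in> I. V i \<noteq> topspace (X i)}"
    and V: "\<And>i. i \<in> I \<Longrightarrow> openin (X i) (V i)"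
    and xV: "restrict x I \<in> Pi\<^sub>E I V" and VU: "Pi\<^sub>E I V \<subseteq> U"
    using U unfolding openin_product_topology_alt by meson
  define J where "J = {i \<in> I. V i \<noteq> topspace (X i)}"
  define G where "G i = {s \<in> S. V i \<inter> B s i \<noteq> {}}" for i
  have "G i \<in> D" if "i \<in> J" for i
    using lim[of i] V[of i] xV that by (auto simp: G_def J_def ultralimit_in_def)
  then have GD: "G ` J \<subseteq> D" by blast
  show "{s \<in> S. U \<inter> Pi\<^sub>E I (B s) \<noteq> {}} \<in> D"
  proof (rule ultrafilter_on_meets[OF D])
    fix A assume "A \<in> D"
    then have "S \<inter> \<Inter>(insert A (G ` J)) \<noteq> {}"
      using GD fin by (intro fip_onD[OF ultrafilter_on_imp_fip_on[OF D]]) (auto simp: J_def)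
    then obtain s where s: "s \<in> S" "s \<in> A" "\<And>i. i \<in> J \<Longrightarrow> s \<in> G i"
      by blast
    have "V i \<inter> B s i \<noteq> {}" if "i \<in> I" for i
    proof (cases "i \<in> J")
      case True
      then show ?thesis using s(3) by (auto simp: G_def)
    next
      case False
      \<comment> \<open>Here \<open>V i\<close> is the whole factor, which contains the nonempty
        \<open>B s i\<close>.\<close>
      then show ?thesis using B[OF s(1) that] that by (auto simp: J_def)
    qed
    then have "Pi\<^sub>E I V \<inter> Pi\<^sub>E I (B s) \<noteq> {}"
      by (simp add: PiE_Int PiE_eq_empty_iff)
    then show "A \<inter> {s \<in> S. U \<inter> Pi\<^sub>E I (B s) \<noteq> {}} \<noteq> {}"
      using s(1,2) VU by auto
  qed auto
qed

lemma ultra_pseudocompact_product_topology: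
  assumes D: "ultrafilter_on S D"
    and X: "\<And>i. i \<in> I \<Longrightarrow> ultra_pseudocompact S D (X i)"
  shows "ultra_pseudocompact S D (product_topology X I)"
  unfolding ultra_pseudocompact_def
proof (intro allI impI)
  fix Q assume Q: "\<forall>s\<in>S. openin (product_topology X I) (Q s) \<and> Q s \<noteq> {}"
  have "\<forall>s\<in>S. \<exists>V. (\<forall>i\<in>I. openin (X i) (V i) \<and> V i \<noteq> {}) \<and> Pi\<^sub>E I V \<subseteq> Q s"
  proof
    fix s assume "s \<in> S"
    then obtain y where "y \<in> Q s" "openin (product_topology X I) (Q s)"
      using Q by blast
    then obtain V where "\<forall>i\<in>I. openin (X i) (V i)" "y \<in> Pi\<^sub>E I V" "Pi\<^sub>E I V \<subseteq> Q s"
      unfolding openin_product_topology_alt by meson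
    then show "\<exists>V. (\<forall>i\<in>I. openin (X i) (V i) \<and> V i \<noteq> {}) \<and> Pi\<^sub>E I V \<subseteq> Q s"
      \<comment> \<open>The point \<open>y\<close> of the box shows each \<open>V i\<close> to be
        nonempty.\<close>
      by (intro exI[of _ V]) auto
  qed
  then obtain B where B: "\<And>s i. s \<in> S \<Longrightarrow> i \<in> I \<Longrightarrow> openin (X i) (B s i) \<and> B s i \<noteq> {}"
    and BO: "\<And>s. s \<in> S \<Longrightarrow> Pi\<^sub>E I (B s) \<subseteq> Q s"
    by metis
  have "\<exists>x. ultralimit_in (X i) S D (\<lambda>s. B s i) x" if "i \<in> I" for i
    using X[OF that, unfolded ultra_pseudocompact_def, rule_format, of "\<lambda>s. B s i"] B that by simp
  then obtain x where "\<And>i. i \<in> I \<Longrightarrow> ultralimit_in (X i) S D (\<lambda>s. B s i) (x i)"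
    by metis
  then have "ultralimit_in (product_topology X I) S D (\<lambda>s. Pi\<^sub>E I (B s)) (restrict x I)"
    using B openin_subset[OF conjunct1[OF B]] by (intro ultralimit_in_product_topology[OF D]) simp_all
  then show "\<exists>x. ultralimit_in (product_topology X I) S D Q x"
    using ultralimit_in_mono[where B = "\<lambda>s. Pi\<^sub>E I (B s)" and Q = Q, OF D _ BO] by blast
qed

section \<open>From limits back to finite subfamilies with dense union\<close>

lemma fip_on_Fpow: "fip_on (Fpow \<U>) ((\<lambda>U. {F \<in> Fpow \<U>. U \<in> F}) ` \<U>)"
proof -
  have "Fpow \<U> \<inter> \<Inter>C \<noteq> {}"
    if C: "C \<subseteq> (\<lambda>U. {F \<in> Fpow \<U>. U \<in> F}) ` \<U>" "finite C" for C
  proof -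
    obtain F where "F \<subseteq> \<U>" "finite F" "C = (\<lambda>U. {F \<in> Fpow \<U>. U \<in> F}) ` F"
      using finite_subset_image[OF C(2,1)] by blast
    \<comment> \<open>The finite set \<open>F\<close> of indices is itself the common point: it
      contains each of its elements.\<close>
    then have "F \<in> Fpow \<U> \<inter> \<Inter>C" by (auto simp: Fpow_def)
    then show ?thesis by blast
  qed
  then show ?thesis by (auto simp: fip_on_def)
qed

lemma ultra_pseudocompact_imp_finite_dense_subfamily:
  assumes D: "ultrafilter_on (Fpow \<U>) D"
    and ext: "(\<lambda>U. {F \<in> Fpow \<U>. U \<in> F}) ` \<U> \<subseteq> D"
    and X: "ultra_pseudocompact (Fpow \<U>) D X"
    and opn: "\<And>U. U \<in> \<U> \<Longrightarrow> openin X U" and cover: "\<Union>\<U> = topspace X"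
  shows "\<exists>\<F>. \<F> \<subseteq> \<U> \<and> finite \<F> \<and> X closure_of \<Union>\<F> = topspace X"
proof (rule ccontr)
  assume no: "\<not> ?thesis"
  define Q where "Q F = topspace X - X closure_of (\<Union>F)" for F
  have "openin X (Q F) \<and> Q F \<noteq> {}" if "F \<in> Fpow \<U>" for F
    using no that closure_of_subset_topspace[of X "\<Union>F"] by (auto simp: Q_def Fpow_def)
  then obtain x where x: "ultralimit_in X (Fpow \<U>) D Q x"
    using X[unfolded ultra_pseudocompact_def, rule_format, of Q] by auto
  then obtain U where U: "U \<in> \<U>" "x \<in> U"
    using cover by (auto simp: ultralimit_in_def)
  have "{F \<in> Fpow \<U>. U \<inter> Q F \<noteq> {}} \<in> D"
    using x U opn by (auto simp: ultralimit_in_def)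
  moreover have "{F \<in> Fpow \<U>. U \<in> F} \<in> D"
    using ext U(1) by blast
  \<comment> \<open>Some \<open>F\<close> lies in both sets: \<open>U\<close> belongs to
    \<open>F\<close>, hence is inside the closure of \<open>\<Union>F\<close>, yet meets the
    complement \<open>Q F\<close> of that closure.\<close>
  ultimately have "Fpow \<U> \<inter> \<Inter>{{F \<in> Fpow \<U>. U \<inter> Q F \<noteq> {}}, {F \<in> Fpow \<U>. U \<in> F}} \<noteq> {}"
    by (intro fip_onD[OF ultrafilter_on_imp_fip_on[OF D]]) auto
  then obtain F where F: "F \<in> Fpow \<U>" "U \<inter> Q F \<noteq> {}" "U \<in> F"
    by blast
  have "\<Union>F \<subseteq> topspace X"
    using F(1) cover by (auto simp: Fpow_def)
  then have "U \<subseteq> X closure_of (\<Union>F)"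
    using F(3) closure_of_subset by blast
  then show False
    using F(2) by (auto simp: Q_def)
qed

text \<open>Passing from \<open>A\<close> to \<open>Field r\<close> helps because
  \<open>ctwo ^c r\<close> is the cardinality of the functions from \<open>Field r\<close> to
  \<open>bool\<close>, that is, of its subsets.\<close>

lemma card_of_Pow_ordLeq_ctwo_cexp:
  assumes "|A| \<le>o r" "Card_order r"
  shows "|Pow A| \<le>o ctwo ^c r"
proof -
  have "|A| \<le>o |Field r|"
    using assms card_of_Field_ordIso ordIso_symmetric ordLeq_ordIso_trans by blast
  then have "|Pow A| \<le>o |Pow (Field r)|"
    by (rule card_of_Pow_mono)
  also have "|Pow (Field r)| =o ctwo ^c r"
    unfolding ctwo_def cexp_def Field_card_of by (rule card_of_Pow_Func)
  finally show ?thesis .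
qed

theorem corollary3:
  fixes lam :: "'l rel" and mu :: "'m rel"
    and I :: "'i set" and X :: "'i \<Rightarrow> 'a topology"
  assumes "Cinfinite lam" and "Cinfinite mu"
    and "ctwo ^c mu \<le>o lam"
    and "\<And>i. i \<in> I \<Longrightarrow> weakly_initially_compact lam (X i)"
  shows "weakly_initially_compact mu (product_topology X I)"
  unfolding weakly_initially_compact_def
proof (intro allI impI)
  let ?P = "product_topology X I"
  fix \<U> assume \<U>: "(\<forall>U\<in>\<U>. openin ?P U) \<and> \<Union>\<U> = topspace ?P \<and> |\<U>| \<le>o mu"
  show "\<exists>\<F>. \<F> \<subseteq> \<U> \<and> finite \<F> \<and> ?P closure_of \<Union>\<F> = topspace ?P"
  \<comment> \<open>The count of finite subsets below requires an infinite cover; a finite one is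
    its own witness.\<close>
  proof (cases "finite \<U>")
    case True
    then show ?thesis
      using \<U> closure_of_topspace[of ?P] by (intro exI[of _ \<U>]) (simp del: topspace_product_topology)
  next
    case False
    obtain D where D: "ultrafilter_on (Fpow \<U>) D"
      and ext: "(\<lambda>U. {F \<in> Fpow \<U>. U \<in> F}) ` \<U> \<subseteq> D"
      using ultrafilter_on_extends[OF fip_on_Fpow] .
    \<comment> \<open>An infinite set has as many finite subsets as elements, so the index set of
      \<open>D\<close> has size at most \<open>mu\<close> and \<open>D\<close> at most
      \<open>ctwo ^c mu\<close>.\<close>
    have "|Fpow \<U>| \<le>o mu"
      using card_of_Fpow_infinite[OF False] \<U> ordIso_ordLeq_trans by blast
    then have "|Pow (Fpow \<U>)| \<le>o lam"
      using card_of_Pow_ordLeq_ctwo_cexp assms(2,3) ordLeq_transitive by blast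
    moreover have "|D| \<le>o |Pow (Fpow \<U>)|"
      using D by (intro card_of_mono1) (auto simp: ultrafilter_on_def fip_on_def)
    ultimately have "|D| \<le>o lam"
      using ordLeq_transitive by blast
    then have "ultra_pseudocompact (Fpow \<U>) D ?P"
      using assms(4) D
      by (intro ultra_pseudocompact_product_topology weakly_initially_compact_imp_ultra_pseudocompact)
    then show ?thesis
      using \<U> by (intro ultra_pseudocompact_imp_finite_dense_subfamily[OF D ext]) auto
  qed
qed

end
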